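(* Let $K$ be a field, let $p\geq 0$ and let $a>i_p>i_{p-1}>\cdots>i_1>i_0=0$ be integers. Let $I_j\subset R'=K[y,z]$, $0\leq j\leq p$, be nonzero proper monomial ideals. Consider the monomial ideal $$I=(x^a)+x^{i_p}I_p + \cdots + x^{i_1}I_1 + I_0 \subset R=K[x,y,z],$$ and assume that $$\mathcal{G}(I)=\{x^a\}\cup \mathcal{G}(x^{i_p}I_p) \cup \cdots \cup \mathcal{G}(x^{i_1}I_1) \cup \mathcal{G}(I_0).$$ Then the following statements are equivalent: (1) $\operatorname{depth}(R/I)=1$. (2) $I_j=(u_j)$, $0\leq j\leq p$, for some monomials $u_j\in K[y,z]$ such that $u_p \mid u_{p-1} \mid \cdots \mid u_0$, and all the divisions are strict.
   Context: $\mathcal{G}(L)$ denotes the unique minimal set of monomial generators of a monomial ideal $L$. Monomial ideals of $K[y,z]$ are extended to $R$ when used inside $R$: $x^{i_j}I_j$ is the ideal of $R$ generated by the monomials $x^{i_j}u$, $u\in\mathcal G(I_j)$. A division $u\mid v$ is strict if $u\neq v$. Depth is with respect to the graded maximal ideal generated by the variables. *)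

theory Defs
  imports
    Complex_Main
    "HOL-Library.Poly_Mapping"
    "HOL-Library.Set_Algebras"
    "HOL-Library.Extended_Nat"
begin

text \<open>
  A polynomial with variables in \<open>'v\<close> and coefficients in \<open>'k\<close> is a finitely supported map
  from exponent vectors \<open>'v \<Rightarrow>\<^sub>0 nat\<close> to \<open>'k\<close>, multiplied by convolution.
\<close>

type_synonym ('v, 'k) pring = "('v \<Rightarrow>\<^sub>0 nat) \<Rightarrow>\<^sub>0 'k"

datatype xyz = X | Y | Z
datatype yz = Y' | Z'

definition var :: "'v \<Rightarrow> ('v, 'k::comm_ring_1) pring"
  where "var v = Poly_Mapping.single (Poly_Mapping.single v 1) 1"

definition monomials :: "('v, 'k::comm_ring_1) pring set"
  where "monomials = (\<lambda>\<alpha>. Poly_Mapping.single \<alpha> 1) ` UNIV"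

text \<open>
  A commutative ring is a module over itself: its submodules (\<open>ideal.subspace\<close>) are the ideals,
  and \<open>ideal.span S\<close> is the ideal generated by \<open>S\<close>.
\<close>

interpretation ideal: module "(*) :: 'a::comm_ring_1 \<Rightarrow> 'a \<Rightarrow> 'a"
  by standard (simp_all add: algebra_simps)

definition monomial_ideal :: "('v, 'k::comm_ring_1) pring set \<Rightarrow> bool"
  where "monomial_ideal L \<longleftrightarrow> (\<exists>S\<subseteq>monomials. L = ideal.span S)"

definition is_min_gens :: "('v, 'k::comm_ring_1) pring set \<Rightarrow> ('v, 'k) pring set \<Rightarrow> bool"
  where "is_min_gens L S \<longleftrightarrow>
    S \<subseteq> monomials \<and> ideal.span S = L \<and> (\<forall>T. T \<subset> S \<longrightarrow> ideal.span T \<noteq> L)"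

text \<open>
  \<open>min_gens L\<close> is only meaningful for monomial ideals; there it is well defined by
  \<open>ex1_min_gens\<close> below.
\<close>

definition min_gens :: "('v, 'k::comm_ring_1) pring set \<Rightarrow> ('v, 'k) pring set"
  where "min_gens L = (THE S. is_min_gens L S)"

text \<open>The inclusion of \<open>K[y,z]\<close> into \<open>K[x,y,z]\<close>, on exponent vectors and on polynomials.\<close>

definition emb_exp :: "(yz \<Rightarrow>\<^sub>0 nat) \<Rightarrow> (xyz \<Rightarrow>\<^sub>0 nat)"
  where "emb_exp \<alpha> =
    Poly_Mapping.single Y (Poly_Mapping.lookup \<alpha> Y') +
    Poly_Mapping.single Z (Poly_Mapping.lookup \<alpha> Z')"

definition emb :: "(yz, 'k::comm_ring_1) pring \<Rightarrow> (xyz, 'k) pring"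
  where "emb f = (\<Sum>\<alpha>\<in>Poly_Mapping.keys f.
    Poly_Mapping.single (emb_exp \<alpha>) (Poly_Mapping.lookup f \<alpha>))"

definition xpow_ideal :: "nat \<Rightarrow> (yz, 'k::comm_ring_1) pring set \<Rightarrow> (xyz, 'k) pring set"
  where "xpow_ideal n J = ideal.span ((\<lambda>u. var X ^ n * emb u) ` min_gens J)"

text \<open>
  Regular sequences on the module \<open>A/I\<close> for an ideal \<open>I\<close> of \<open>A\<close>, with cosets replaced by
  representatives: modulo the submodule generated by its predecessors each term is a nonzerodivisor
  on the quotient module, and the quotient of \<open>A/I\<close> by all the terms is nonzero.
\<close>

definition regular_sequence_quot :: "'a::comm_ring_1 set \<Rightarrow> 'a list \<Rightarrow> bool"
  where "regular_sequence_quot I fs \<longleftrightarrow>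
    (\<forall>k<length fs. \<forall>g. fs ! k * g \<in> ideal.span (I \<union> set (take k fs))
        \<longrightarrow> g \<in> ideal.span (I \<union> set (take k fs))) \<and>
    ideal.span (I \<union> set fs) \<noteq> UNIV"

text \<open>\<open>depth_quot \<mm> I\<close> is the depth of \<open>A/I\<close> with respect to \<open>\<mm>\<close>.\<close>

definition depth_quot :: "'a::comm_ring_1 set \<Rightarrow> 'a set \<Rightarrow> enat"
  where "depth_quot \<mm> I = (SUP fs\<in>{fs. set fs \<subseteq> \<mm> \<and> regular_sequence_quot I fs}. enat (length fs))"

definition graded_max_ideal :: "('v, 'k::comm_ring_1) pring set"
  where "graded_max_ideal = ideal.span (range var)"

lemma dvd_of_mem_span_monomials:
  fixes S :: "('v, 'k::comm_ring_1) pring set"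
  assumes "f \<in> ideal.span S" "S \<subseteq> monomials" "\<alpha> \<in> Poly_Mapping.keys f"
  shows "\<exists>m\<in>S. m dvd Poly_Mapping.single \<alpha> 1"
  using assms(1,3)
proof (induction arbitrary: \<alpha> rule: ideal.span_induct_alt)
  case base
  then show ?case by simp
next
  case (step c m g)
  from step.prems Poly_Mapping.keys_add[of "c * m" g]
  consider "\<alpha> \<in> Poly_Mapping.keys (c * m)" | "\<alpha> \<in> Poly_Mapping.keys g" by blast
  then show ?case
  proof cases
    case 1
    obtain \<beta> where m: "m = Poly_Mapping.single \<beta> 1"
      using step.hyps assms(2) by (auto simp: monomials_def)
    obtain \<gamma> where "\<alpha> = \<gamma> + \<beta>"
      using 1 keys_mult[of c m] by (auto simp: m split: if_splits)
    then have "Poly_Mapping.single \<alpha> 1 = m * Poly_Mapping.single \<gamma> 1"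
      by (simp add: m mult_single add.commute)
    then show ?thesis using step.hyps by (metis dvd_triv_left)
  next
    case 2
    then show ?thesis using step.IH by blast
  qed
qed

lemma monomial_dvd_imp_le:
  fixes \<alpha> \<beta> :: "'v \<Rightarrow>\<^sub>0 nat"
  assumes "(Poly_Mapping.single \<beta> 1 :: ('v, 'k::comm_ring_1) pring) dvd Poly_Mapping.single \<alpha> 1"
  shows "\<exists>\<gamma>. \<alpha> = \<beta> + \<gamma>"
proof -
  obtain c :: "('v, 'k) pring"
    where "Poly_Mapping.single \<alpha> 1 = Poly_Mapping.single \<beta> 1 * c" using assms by blast
  then have "\<alpha> \<in> Poly_Mapping.keys (Poly_Mapping.single \<beta> 1 * c)"
    by (metis keys_single zero_neq_one insertI1)
  then show ?thesis
    using keys_mult[of "Poly_Mapping.single \<beta> 1" c] by (auto split: if_splits)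
qed

lemma monomial_dvd_antisym:
  fixes m n :: "('v, 'k::comm_ring_1) pring"
  assumes "m \<in> monomials" "n \<in> monomials" "m dvd n" "n dvd m"
  shows "m = n"
proof -
  obtain \<alpha> \<beta> where e: "m = Poly_Mapping.single \<alpha> 1" "n = Poly_Mapping.single \<beta> 1"
    using assms(1,2) by (auto simp: monomials_def)
  obtain \<gamma> \<delta> where "\<beta> = \<alpha> + \<gamma>" "\<alpha> = \<beta> + \<delta>"
    using monomial_dvd_imp_le assms(3,4) unfolding e by metis
  then have "Poly_Mapping.lookup \<alpha> v = Poly_Mapping.lookup \<beta> v" for v
    by (metis lookup_add le_add1 le_antisym)
  then have "\<alpha> = \<beta>" by (rule poly_mapping_eqI)
  then show ?thesis by (simp add: e)
qed

lemma min_gens_antichain: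
  assumes "is_min_gens L S" "m \<in> S" "n \<in> S" "m dvd n"
  shows "m = n"
proof (rule ccontr)
  assume "m \<noteq> n"
  then have "m \<in> ideal.span (S - {n})"
    using assms by (auto intro: ideal.span_base)
  then have "n \<in> ideal.span (S - {n})"
    using assms(4) ideal.span_scale by (metis dvdE mult.commute)
  then have "ideal.span (S - {n}) = ideal.span S"
    by (intro subset_antisym ideal.span_mono ideal.span_minimal)
      (auto intro: ideal.span_base)
  then show False using assms unfolding is_min_gens_def by blast
qed

lemma min_gens_subset:
  fixes L S T :: "('v, 'k::comm_ring_1) pring set"
  assumes "is_min_gens L S" "is_min_gens L T"
  shows "S \<subseteq> T"
proof
  have mono: "S \<subseteq> monomials" "T \<subseteq> monomials" and sp: "ideal.span S = L" "ideal.span T = L"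
    using assms by (auto simp: is_min_gens_def)
  have *: "\<exists>n\<in>B. n dvd m"
    if AB: "m \<in> A" "A \<subseteq> monomials" "B \<subseteq> monomials" "ideal.span A = ideal.span B"
    for A B :: "('v, 'k) pring set" and m
  proof -
    obtain \<alpha> where "m = Poly_Mapping.single \<alpha> 1" using AB(1,2) unfolding monomials_def by blast
    moreover have "m \<in> ideal.span B" using AB ideal.span_base by blast
    ultimately show ?thesis using dvd_of_mem_span_monomials[of m B \<alpha>] AB by simp
  qed
  fix m assume m: "m \<in> S"
  obtain n where n: "n \<in> T" "n dvd m" using *[of m S T] m mono sp by auto
  obtain m' where m': "m' \<in> S" "m' dvd n" using *[of n T S] n mono sp by auto
  have "m' = m" using min_gens_antichain[OF assms(1) m'(1) m] m' n dvd_trans by blast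
  then have "n = m" using monomial_dvd_antisym[of n m] n m m' mono by blast
  then show "m \<in> T" using n by simp
qed

lemma ex1_min_gens:
  fixes L :: "('v::finite, 'k::comm_ring_1) pring set"
  assumes "monomial_ideal L"
  shows "\<exists>!S. is_min_gens L S"
proof -
  obtain S where S: "S \<subseteq> monomials" "L = ideal.span S"
    using assms by (auto simp: monomial_ideal_def)
  define M where "M = {m \<in> S. \<forall>n\<in>S. n dvd m \<longrightarrow> n = m}"
  define deg where "deg \<alpha> = (\<Sum>v\<in>UNIV. Poly_Mapping.lookup \<alpha> v)" for \<alpha> :: "'v \<Rightarrow>\<^sub>0 nat"
  have below: "\<exists>n\<in>M. n dvd Poly_Mapping.single \<alpha> 1" if "Poly_Mapping.single \<alpha> 1 \<in> S" for \<alpha>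
    using that
  proof (induction "deg \<alpha>" arbitrary: \<alpha> rule: less_induct)
    case less
    show ?case
    proof (cases "Poly_Mapping.single \<alpha> 1 \<in> M")
      case False
      then obtain n where n: "n \<in> S" "n dvd Poly_Mapping.single \<alpha> 1" "n \<noteq> Poly_Mapping.single \<alpha> 1"
        using less.prems by (auto simp: M_def)
      obtain \<beta> where \<beta>: "n = Poly_Mapping.single \<beta> 1" using n S by (auto simp: monomials_def)
      obtain \<gamma> where \<gamma>: "\<alpha> = \<beta> + \<gamma>" using monomial_dvd_imp_le n(2) unfolding \<beta> by blast
      have "\<gamma> \<noteq> 0" using n(3) by (auto simp: \<beta> \<gamma>)
      then have "deg \<gamma> \<noteq> 0" by (metis deg_def poly_mapping_eqI lookup_zero sum_eq_0_iff finite UNIV_I)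
      moreover have "deg \<alpha> = deg \<beta> + deg \<gamma>" by (simp add: deg_def \<gamma> lookup_add sum.distrib)
      ultimately show ?thesis using less.hyps[of \<beta>] n \<beta> by (metis dvd_trans less_add_same_cancel1 neq0_conv)
    qed (use dvd_refl in blast)
  qed
  have "m \<in> ideal.span M" if m: "m \<in> S" for m
  proof -
    obtain \<alpha> where "m = Poly_Mapping.single \<alpha> 1" using m S(1) unfolding monomials_def by blast
    then obtain n where "n \<in> M" "n dvd m" using below m by blast
    then show ?thesis by (metis dvdE mult.commute ideal.span_scale ideal.span_base)
  qed
  then have "ideal.span S \<subseteq> ideal.span M" by (simp add: ideal.span_minimal subsetI)
  moreover have "ideal.span M \<subseteq> ideal.span S" by (rule ideal.span_mono) (auto simp: M_def)
  ultimately have "ideal.span M = L" using S by simp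
  moreover have "ideal.span T \<noteq> L" if T: "T \<subset> M" for T
  proof
    assume eq: "ideal.span T = L"
    obtain m where m: "m \<in> M" "m \<notin> T" using T by blast
    obtain \<alpha> where \<alpha>: "m = Poly_Mapping.single \<alpha> 1" using m S by (auto simp: M_def monomials_def)
    have "m \<in> ideal.span T" using m S eq by (auto simp: M_def intro: ideal.span_base)
    moreover have "T \<subseteq> monomials" using T S by (auto simp: M_def)
    ultimately obtain n where "n \<in> T" "n dvd m"
      using dvd_of_mem_span_monomials[of m T \<alpha>] \<alpha> by auto
    then show False using m T by (auto simp: M_def)
  qed
  ultimately have "is_min_gens L M" using S by (auto simp: is_min_gens_def M_def)
  then show ?thesis using min_gens_subset by (metis subset_antisym)
qed

end

theory Submission
  imports Defs
begin

text \<open>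
  Since a power of \<open>x\<close> lies in \<open>I\<close>, the depth of \<open>R/I\<close> is governed by the slices of \<open>I\<close> at the powers
  of \<open>x\<close>: \<open>R/I\<close> is the direct sum over \<open>n < a\<close> of the modules \<open>x\<^sup>n K[y,z]/L\<^sub>n\<close>, where \<open>L\<^sub>n\<close> is the
  sum of the \<open>I\<^sub>j\<close> with \<open>i\<^sub>j \<le> n\<close>. Each \<open>L\<^sub>n\<close> is a nonzero proper monomial ideal in two variables, and
  \<open>K[y,z]/L\<^sub>n\<close> has a socle unless \<open>L\<^sub>n\<close> is principal. So the depth is one exactly if every slice is principal.

  The hypothesis on minimal generators turns principal slices into the chain \<open>u\<^sub>p \<bar> \<dots> \<bar> u\<^sub>0\<close>: it
  prevents \<open>I\<^sub>k\<close> from being contained in an earlier \<open>I\<^sub>j\<close>, and hence the generator of the \<open>k\<close>-th slice,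
  which lies in one of \<open>I\<^sub>0, \<dots>, I\<^sub>k\<close>, must lie in \<open>I\<^sub>k\<close> and generate it (\<open>principal_chain_if_depth\<close>).
  Conversely a chain makes every slice principal (\<open>depth_if_principal_chain\<close>).

  Depth is the supremum of lengths of arbitrary regular sequences, homogeneous or not. Three elementary facts
  about monomial ideals give all the values needed: a socle element forces depth zero
  (\<open>depth_quot_eq_0_if_socle\<close>); a monomial outside \<open>I\<close> annihilated by all variables but one
  bounds the depth by one (\<open>depth_quot_le_1\<close>); and \<open>y + z\<close> is regular if no monomial outside \<open>I\<close> is
  torsion for both \<open>y\<close> and \<open>z\<close> (\<open>var_add_var_regular\<close>).
\<close>

section \<open>Monomial ideals and their exponent vectors\<close>

text \<open>
  For a ring acting on itself this simplification rule is associativity, oriented from right to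
  left, so that rewriting with the usual associativity law would loop.
\<close>

declare ideal.scale_scale [simp del]

abbreviation mon :: "('v \<Rightarrow>\<^sub>0 nat) \<Rightarrow> ('v, 'k::comm_ring_1) pring"
  where "mon \<alpha> \<equiv> Poly_Mapping.single \<alpha> 1"

abbreviation unit_exp :: "'v \<Rightarrow> 'v \<Rightarrow>\<^sub>0 nat"
  where "unit_exp v \<equiv> Poly_Mapping.single v 1"

text \<open>
  A monomial ideal is determined by its exponent vectors, which turns statements about ideals
  into combinatorics of vectors of natural numbers.
\<close>

definition exps :: "('v, 'k::comm_ring_1) pring set \<Rightarrow> ('v \<Rightarrow>\<^sub>0 nat) set"
  where "exps L = {\<alpha>. mon \<alpha> \<in> L}"

lemma exponent_dvd_iff:
  fixes \<alpha> \<beta> :: "'v \<Rightarrow>\<^sub>0 nat"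
  shows "(\<exists>\<gamma>. \<alpha> = \<beta> + \<gamma>) \<longleftrightarrow> (\<forall>v. Poly_Mapping.lookup \<beta> v \<le> Poly_Mapping.lookup \<alpha> v)"
proof
  assume "\<forall>v. Poly_Mapping.lookup \<beta> v \<le> Poly_Mapping.lookup \<alpha> v"
  then have "\<alpha> = \<beta> + (\<alpha> - \<beta>)"
    by (intro poly_mapping_eqI) (simp add: lookup_add lookup_minus)
  then show "\<exists>\<gamma>. \<alpha> = \<beta> + \<gamma>" ..
qed (auto simp: lookup_add)

lemma exponent_split_var:
  fixes \<alpha> :: "'v \<Rightarrow>\<^sub>0 nat"
  assumes "Poly_Mapping.lookup \<alpha> v \<noteq> 0"
  obtains \<beta> where "\<alpha> = unit_exp v + \<beta>"
  using exponent_dvd_iff[of \<alpha> "unit_exp v"] assms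
  by (auto simp: lookup_single when_def Suc_le_eq)

lemma mon_dvd_iff:
  "(mon \<beta> :: ('v, 'k::comm_ring_1) pring) dvd mon \<alpha> \<longleftrightarrow> (\<exists>\<gamma>. \<alpha> = \<beta> + \<gamma>)"
proof
  assume "\<exists>\<gamma>. \<alpha> = \<beta> + \<gamma>"
  then show "(mon \<beta> :: ('v, 'k) pring) dvd mon \<alpha>"
    by (metis dvd_triv_left mult.right_neutral mult_single)
qed (rule monomial_dvd_imp_le)

lemma var_times_mon: "var v * mon \<alpha> = mon (unit_exp v + \<alpha>)"
  by (simp add: var_def mult_single)

lemma var_power: "var v ^ n = mon (Poly_Mapping.single v n)"
  by (induction n) (simp_all add: var_times_mon flip: single_add)

lemma sum_of_terms:
  fixes f :: "('v, 'k::comm_ring_1) pring"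
  shows "f = (\<Sum>\<alpha>\<in>Poly_Mapping.keys f. Poly_Mapping.single 0 (Poly_Mapping.lookup f \<alpha>) * mon \<alpha>)"
  by (rule poly_mapping_eqI)
    (simp add: lookup_sum mult_single lookup_single when_def in_keys_iff)

lemma lookup_mon_times:
  fixes f :: "('v, 'k::comm_ring_1) pring"
  shows "Poly_Mapping.lookup (mon \<alpha> * f) (\<alpha> + \<beta>) = Poly_Mapping.lookup f \<beta>"
proof -
  have "mon \<alpha> * f = (\<Sum>\<gamma>\<in>Poly_Mapping.keys f. Poly_Mapping.single (\<alpha> + \<gamma>) (Poly_Mapping.lookup f \<gamma>))"
    by (subst sum_of_terms) (simp add: sum_distrib_left mult_single)
  then show ?thesis
    by (simp add: lookup_sum lookup_single when_def in_keys_iff)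
qed

lemma mem_span_monomials_iff:
  fixes S :: "('v, 'k::comm_ring_1) pring set"
  assumes "S \<subseteq> monomials"
  shows "f \<in> ideal.span S \<longleftrightarrow> (\<forall>\<alpha>\<in>Poly_Mapping.keys f. \<exists>m\<in>S. m dvd mon \<alpha>)"
proof
  assume *: "\<forall>\<alpha>\<in>Poly_Mapping.keys f. \<exists>m\<in>S. m dvd mon \<alpha>"
  have "mon \<alpha> \<in> ideal.span S" if "\<alpha> \<in> Poly_Mapping.keys f" for \<alpha>
    using * that by (metis dvdE ideal.span_base ideal.span_scale mult.commute)
  then show "f \<in> ideal.span S"
    by (subst sum_of_terms) (intro ideal.span_sum ideal.span_scale)
qed (use dvd_of_mem_span_monomials assms in blast)

lemma mon_in_monomials: "mon \<alpha> \<in> monomials"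
  by (simp add: monomials_def)

lemma monomial_ideal_subspace: "monomial_ideal L \<Longrightarrow> ideal.subspace L"
  by (auto simp: monomial_ideal_def)

text \<open>Monomial ideals are the ideals that can be tested term by term.\<close>

lemma mem_monomial_ideal_iff:
  assumes "monomial_ideal L"
  shows "f \<in> L \<longleftrightarrow> Poly_Mapping.keys f \<subseteq> exps L"
proof -
  obtain S where S: "S \<subseteq> monomials" "L = ideal.span S"
    using assms by (auto simp: monomial_ideal_def)
  show ?thesis
    using mem_span_monomials_iff[OF S(1)] by (auto simp: S(2) exps_def)
qed

lemma exps_add:
  assumes "ideal.subspace L" "\<alpha> \<in> exps L"
  shows "\<beta> + \<alpha> \<in> exps L"
  using ideal.subspace_scale[OF assms(1), of "mon \<alpha>" "mon \<beta>"] assms(2)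
  by (simp add: exps_def mult_single)

lemma exps_span:
  assumes "S \<subseteq> monomials"
  shows "\<alpha> \<in> exps (ideal.span S) \<longleftrightarrow> (\<exists>m\<in>S. m dvd mon \<alpha>)"
  using mem_span_monomials_iff[OF assms] by (simp add: exps_def)

lemma exps_span_mon: "\<beta> \<in> exps (ideal.span {mon \<gamma>} :: ('v, 'k::comm_ring_1) pring set) \<longleftrightarrow> (\<exists>\<delta>. \<beta> = \<gamma> + \<delta>)"
  using exps_span[of "{mon \<gamma>} :: ('v, 'k) pring set" \<beta>] by (simp add: mon_in_monomials mon_dvd_iff)

lemma monomial_ideal_span_mon: "monomial_ideal (ideal.span {mon \<gamma>})"
  using mon_in_monomials[of \<gamma>] unfolding monomial_ideal_def by blast

lemma monomial_ideal_eqI: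
  assumes "monomial_ideal L" "monomial_ideal M" "exps L = exps M"
  shows "L = M"
  using assms by (auto simp: mem_monomial_ideal_iff)

lemma var_in_monomials: "var v \<in> monomials"
  by (simp add: var_def mon_in_monomials)

lemma mem_span_vars_iff:
  fixes f :: "('v, 'k::comm_ring_1) pring"
  shows "f \<in> ideal.span (var ` V) \<longleftrightarrow> (\<forall>\<alpha>\<in>Poly_Mapping.keys f. \<exists>v\<in>V. Poly_Mapping.lookup \<alpha> v \<noteq> 0)"
proof -
  have "(var v :: ('v, 'k) pring) dvd mon \<alpha> \<longleftrightarrow> Poly_Mapping.lookup \<alpha> v \<noteq> 0" for v \<alpha>
    unfolding var_def mon_dvd_iff by (metis exponent_split_var lookup_add add_is_0 lookup_single_eq zero_neq_one)
  moreover have "(var ` V :: ('v, 'k) pring set) \<subseteq> monomials" by (simp add: image_subset_iff var_in_monomials)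
  ultimately show ?thesis by (simp add: mem_span_monomials_iff)
qed

lemma graded_max_ideal_iff:
  "f \<in> graded_max_ideal \<longleftrightarrow> Poly_Mapping.lookup f 0 = 0"
proof -
  have "(\<exists>v. Poly_Mapping.lookup \<alpha> v \<noteq> 0) \<longleftrightarrow> \<alpha> \<noteq> 0" for \<alpha> :: "'a \<Rightarrow>\<^sub>0 nat"
    by (metis lookup_zero poly_mapping_eqI)
  then show ?thesis
    unfolding graded_max_ideal_def mem_span_vars_iff
    by (metis UNIV_I in_keys_iff)
qed

text \<open>
  A monomial lies in a sum of monomial ideals only if it lies in one of the summands, because
  some generator of the sum divides it.
\<close>

lemma monomial_ideal_set_plus:
  assumes "monomial_ideal L" "monomial_ideal M"
  shows "monomial_ideal (L + M)" "exps (L + M) = exps L \<union> exps M"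
proof -
  obtain S T where S: "S \<subseteq> monomials" "L = ideal.span S" and T: "T \<subseteq> monomials" "M = ideal.span T"
    using assms by (auto simp: monomial_ideal_def)
  have eq: "L + M = ideal.span (S \<union> T)"
    by (auto simp: S T ideal.span_Un set_plus_def)
  show "monomial_ideal (L + M)"
    unfolding monomial_ideal_def eq using S(1) T(1) by (intro exI[of _ "S \<union> T"]) simp
  show "exps (L + M) = exps L \<union> exps M"
    unfolding eq unfolding S(2) T(2) using S(1) T(1) by (simp add: set_eq_iff exps_span bex_Un)
qed

lemma monomial_ideal_sum:
  fixes L :: "'j \<Rightarrow> ('v, 'k::comm_ring_1) pring set"
  assumes "finite A" "\<forall>j\<in>A. monomial_ideal (L j)"
  shows "monomial_ideal (\<Sum>j\<in>A. L j) \<and> exps (\<Sum>j\<in>A. L j) = (\<Union>j\<in>A. exps (L j))"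
  using assms
proof (induction A rule: finite_induct)
  case empty
  have "0 = ideal.span ({} :: ('v, 'k) pring set)" by simp
  then have "monomial_ideal (0 :: ('v, 'k) pring set)" unfolding monomial_ideal_def by blast
  moreover have "mon \<alpha> \<noteq> (0 :: ('v, 'k) pring)" for \<alpha>
    by (metis lookup_single_eq lookup_zero zero_neq_one)
  ultimately show ?case by (simp add: exps_def)
next
  case (insert j A)
  then show ?case using monomial_ideal_set_plus[of "L j" "\<Sum>j\<in>A. L j"] by simp
qed

section \<open>Monomials in three variables\<close>

lemma all_yz: "(\<forall>v. P v) \<longleftrightarrow> P Y' \<and> P Z'"
  by (metis yz.exhaust)

lemma all_xyz: "(\<forall>v. P v) \<longleftrightarrow> P X \<and> P Y \<and> P Z"
  by (metis xyz.exhaust)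

instance yz :: finite
proof
  have "(UNIV :: yz set) \<subseteq> {Y', Z'}" using yz.exhaust by blast
  then show "finite (UNIV :: yz set)" using finite_subset by blast
qed

instance xyz :: finite
proof
  have "(UNIV :: xyz set) \<subseteq> {X, Y, Z}" using xyz.exhaust by blast
  then show "finite (UNIV :: xyz set)" using finite_subset by blast
qed

lemma is_min_gens_min_gens:
  fixes L :: "('v::finite, 'k::comm_ring_1) pring set"
  assumes "monomial_ideal L"
  shows "is_min_gens L (min_gens L)"
  unfolding min_gens_def using ex1_min_gens[OF assms] by (rule theI')

text \<open>
  Every exponent vector of \<open>K[x,y,z]\<close> has this form for exactly one pair, so a monomial ideal of
  \<open>K[x,y,z]\<close> can be described by what it looks like at each power of \<open>x\<close>.
\<close>

definition xexp :: "nat \<Rightarrow> (yz \<Rightarrow>\<^sub>0 nat) \<Rightarrow> xyz \<Rightarrow>\<^sub>0 nat"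
  where "xexp n \<beta> = Poly_Mapping.single X n + emb_exp \<beta>"

lemma lookup_xexp [simp]:
  "Poly_Mapping.lookup (xexp n \<beta>) X = n"
  "Poly_Mapping.lookup (xexp n \<beta>) Y = Poly_Mapping.lookup \<beta> Y'"
  "Poly_Mapping.lookup (xexp n \<beta>) Z = Poly_Mapping.lookup \<beta> Z'"
  by (simp_all add: xexp_def emb_exp_def lookup_add lookup_single)

lemma xexp_cases:
  obtains n \<beta> where "\<alpha> = xexp n \<beta>"
proof
  define \<beta> where "\<beta> = Poly_Mapping.single Y' (Poly_Mapping.lookup \<alpha> Y) +
    Poly_Mapping.single Z' (Poly_Mapping.lookup \<alpha> Z)"
  show "\<alpha> = xexp (Poly_Mapping.lookup \<alpha> X) \<beta>"
  proof (rule poly_mapping_eqI)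
    fix v show "Poly_Mapping.lookup \<alpha> v = Poly_Mapping.lookup (xexp (Poly_Mapping.lookup \<alpha> X) \<beta>) v"
      by (cases v) (simp_all add: \<beta>_def lookup_add lookup_single)
  qed
qed

lemma xexp_dvd_iff:
  "(\<exists>\<gamma>. xexp n \<beta> = xexp k \<beta>' + \<gamma>) \<longleftrightarrow> k \<le> n \<and> (\<exists>\<gamma>. \<beta> = \<beta>' + \<gamma>)"
  unfolding exponent_dvd_iff all_xyz all_yz by simp

lemma unit_exp_add_xexp:
  "unit_exp X + xexp n \<beta> = xexp (Suc n) \<beta>"
  "Poly_Mapping.single Y k + xexp n \<beta> = xexp n (Poly_Mapping.single Y' k + \<beta>)"
  "Poly_Mapping.single Z k + xexp n \<beta> = xexp n (Poly_Mapping.single Z' k + \<beta>)"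
  by (simp_all add: poly_mapping_eq_iff fun_eq_iff all_xyz lookup_add lookup_single)

lemma xpow_ideal_exps:
  assumes "monomial_ideal J"
  shows "monomial_ideal (xpow_ideal n J)"
    and "xexp k \<beta> \<in> exps (xpow_ideal n J) \<longleftrightarrow> n \<le> k \<and> \<beta> \<in> exps J"
proof -
  have G: "min_gens J \<subseteq> monomials" "ideal.span (min_gens J) = J"
    using is_min_gens_min_gens[OF assms] by (auto simp: is_min_gens_def)
  have img: "var X ^ n * emb (mon \<gamma>) = mon (xexp n \<gamma>)" for \<gamma>
    by (simp add: emb_def var_power mult_single xexp_def)
  have S: "(\<lambda>u. var X ^ n * emb u) ` min_gens J \<subseteq> monomials"
    using G(1) by (auto simp: monomials_def img)
  then show "monomial_ideal (xpow_ideal n J)"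
    unfolding monomial_ideal_def xpow_ideal_def by blast
  have "xexp k \<beta> \<in> exps (xpow_ideal n J) \<longleftrightarrow>
      (\<exists>u\<in>min_gens J. var X ^ n * emb u dvd mon (xexp k \<beta>))"
    unfolding xpow_ideal_def exps_span[OF S] by simp
  also have "\<dots> \<longleftrightarrow> (\<exists>u\<in>min_gens J. n \<le> k \<and> u dvd mon \<beta>)"
  proof (intro bex_cong refl)
    fix u assume "u \<in> min_gens J"
    then obtain \<gamma> where "u = mon \<gamma>" using G(1) by (auto simp: monomials_def)
    then show "var X ^ n * emb u dvd mon (xexp k \<beta>) \<longleftrightarrow> n \<le> k \<and> u dvd mon \<beta>"
      by (simp only: img mon_dvd_iff xexp_dvd_iff)
  qed
  also have "\<dots> \<longleftrightarrow> n \<le> k \<and> \<beta> \<in> exps J"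
    using exps_span[OF G(1)] G(2) by auto
  finally show "xexp k \<beta> \<in> exps (xpow_ideal n J) \<longleftrightarrow> n \<le> k \<and> \<beta> \<in> exps J" .
qed

section \<open>Bounds on the depth of a quotient by a monomial ideal\<close>

lemma annihilator_subspace:
  assumes "ideal.subspace I"
  shows "ideal.subspace {f. f * s \<in> I}"
  using assms by (simp add: ideal.subspace_def distrib_right mult.assoc)

lemma span_vars_annihilates:
  assumes "ideal.subspace I" "\<And>v. v \<in> V \<Longrightarrow> var v * s \<in> I" "f \<in> ideal.span (var ` V)"
  shows "f * s \<in> I"
proof -
  have "ideal.span (var ` V) \<subseteq> {f. f * s \<in> I}"
    using assms(1,2) by (intro ideal.span_minimal annihilator_subspace) auto
  then show ?thesis using assms(3) by (simp add: subset_iff)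
qed

text \<open>
  A socle element of the quotient is annihilated by the whole maximal ideal, so no element of the
  maximal ideal can start a regular sequence.
\<close>

lemma depth_quot_eq_0_if_socle:
  assumes "ideal.subspace I" "s \<notin> I" "\<And>v. var v * s \<in> I"
  shows "depth_quot graded_max_ideal I = 0"
proof -
  have "fs = []" if fs: "set fs \<subseteq> graded_max_ideal" "regular_sequence_quot I fs" for fs
  proof (rule ccontr)
    assume "fs \<noteq> []"
    then have "fs ! 0 \<in> graded_max_ideal" and len: "0 < length fs" using fs(1) by auto
    then have "fs ! 0 * s \<in> I"
      using span_vars_annihilates[OF assms(1,3)] by (simp add: graded_max_ideal_def)
    moreover have "\<forall>g. fs ! 0 * g \<in> ideal.span (I \<union> set (take 0 fs)) \<longrightarrow> g \<in> ideal.span (I \<union> set (take 0 fs))"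
      using fs(2) len unfolding regular_sequence_quot_def by blast
    moreover have "ideal.span I = I" using assms(1) by simp
    ultimately show False using assms(2) by simp
  qed
  then have "depth_quot graded_max_ideal I \<le> 0"
    unfolding depth_quot_def by (intro SUP_least) (auto simp: zero_enat_def)
  then show ?thesis by simp
qed

lemma depth_quot_ge_1:
  assumes "ideal.subspace I" "I \<subseteq> graded_max_ideal" "f \<in> graded_max_ideal" "\<And>g. f * g \<in> I \<Longrightarrow> g \<in> I"
  shows "1 \<le> depth_quot graded_max_ideal I"
proof -
  have "ideal.span (I \<union> {f}) \<subseteq> graded_max_ideal"
    using assms(2,3) by (intro ideal.span_minimal) (auto simp: graded_max_ideal_def)
  moreover have "1 \<notin> graded_max_ideal" by (simp add: graded_max_ideal_iff)
  moreover have span: "ideal.span I = I" using assms(1) by simp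
  ultimately have "regular_sequence_quot I [f]"
    using assms(4) by (auto simp: regular_sequence_quot_def span)
  then have "enat (length [f]) \<le> depth_quot graded_max_ideal I"
    unfolding depth_quot_def using assms(3) by (intro SUP_upper) simp
  then show ?thesis by (simp add: one_enat_def)
qed

text \<open>
  Over a field this is the bound of the depth by the dimension of an associated prime, for the prime
  \<open>P\<close> generated by all variables but \<open>z\<close>; the argument is the following computation with monomials.
  Suppose that \<open>f, g\<close> is a regular sequence, put \<open>Q = I + (f)\<close>, and let \<open>\<sigma>\<close> be of least degree among
  the monomials outside \<open>I\<close> that \<open>P\<close> multiplies into \<open>I\<close>. Modulo \<open>P\<close> the element \<open>g\<close> is a multiple of
  \<open>z\<close>, so \<open>w z \<sigma> \<in> Q\<close> implies \<open>w g \<sigma> \<in> Q\<close> and hence \<open>w \<sigma> \<in> Q\<close>. Now \<open>f \<sigma> \<in> Q\<close>, and \<open>f\<close> is nonzero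
  modulo \<open>P\<close> because \<open>f \<sigma>\<close> is not in \<open>I\<close>; dividing by powers of \<open>z\<close> modulo \<open>P\<close> gives \<open>h \<sigma> \<in> Q\<close> for
  some \<open>h\<close> with nonzero constant term. Write \<open>h \<sigma> - q f \<in> I\<close>. Regularity of \<open>f\<close> shows that \<open>P\<close>
  multiplies \<open>q\<close> into \<open>I\<close> as well. Since \<open>\<sigma>\<close> is not in \<open>I\<close>, it occurs in \<open>q f\<close>; as \<open>f\<close> has no constant
  term, a proper divisor of \<open>\<sigma>\<close> occurs in \<open>q\<close>, which contradicts the choice of \<open>\<sigma>\<close>.
\<close>

lemma depth_quot_le_1:
  fixes I :: "('v::finite, 'k::comm_ring_1) pring set"
  assumes I: "monomial_ideal I"
    and ex: "\<sigma>\<^sub>0 \<notin> exps I" "\<And>v. v \<noteq> z \<Longrightarrow> unit_exp v + \<sigma>\<^sub>0 \<in> exps I"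
  shows "depth_quot graded_max_ideal I \<le> 1"
proof -
  have sub: "ideal.subspace I" using I by (rule monomial_ideal_subspace)
  define N where "N = {\<tau>. \<tau> \<notin> exps I \<and> (\<forall>v. v \<noteq> z \<longrightarrow> unit_exp v + \<tau> \<in> exps I)}"
  define deg where "deg \<tau> = (\<Sum>v\<in>UNIV. Poly_Mapping.lookup \<tau> v)" for \<tau> :: "'v \<Rightarrow>\<^sub>0 nat"
  have "\<sigma>\<^sub>0 \<in> N" using ex by (simp add: N_def)
  then obtain \<sigma> where \<sigma>: "\<sigma> \<in> N" "\<And>\<tau>. \<tau> \<in> N \<Longrightarrow> deg \<sigma> \<le> deg \<tau>"
    using ex_has_least_nat[of "\<lambda>\<tau>. \<tau> \<in> N" \<sigma>\<^sub>0 deg] by blast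
  have minimal: "\<gamma> = 0" if "\<tau> \<in> N" "\<sigma> = \<tau> + \<gamma>" for \<tau> \<gamma>
  proof -
    have "deg \<sigma> = deg \<tau> + deg \<gamma>" by (simp add: deg_def that(2) lookup_add sum.distrib)
    then have "deg \<gamma> = 0" using \<sigma>(2)[OF that(1)] by simp
    then show ?thesis by (intro poly_mapping_eqI) (simp add: deg_def)
  qed
  define P :: "('v, 'k) pring set" where "P = ideal.span (var ` (- {z}))"
  have P: "r * mon \<sigma> \<in> I" if "r \<in> P" for r
    using span_vars_annihilates[OF sub, of "- {z}" "mon \<sigma>" r] \<sigma>(1) that
    by (auto simp: P_def N_def var_times_mon exps_def)
  \<comment> \<open>An element without constant term is a multiple of \<open>z\<close> modulo \<open>P\<close>.\<close>
  have decompose: "\<exists>w'. w - w' * var z \<in> P" if "w \<in> graded_max_ideal" for w :: "('v, 'k) pring"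
  proof -
    have "insert z (- {z}) = UNIV" by blast
    then have "range var = insert (var z) (var ` (- {z}))" by (metis image_insert)
    then show ?thesis
      using that ideal.span_breakdown_eq unfolding graded_max_ideal_def P_def by metis
  qed
  have "length fs \<le> 1" if fs: "set fs \<subseteq> graded_max_ideal" "regular_sequence_quot I fs" for fs
  proof (rule ccontr)
    assume "\<not> length fs \<le> 1"
    then obtain f g hs where fgs: "fs = f # g # hs"
      by (metis One_nat_def Suc_le_mono length_Cons list.exhaust list.size(3) nle_le zero_le)
    define Q where "Q = ideal.span (insert f I)"
    have m: "f \<in> graded_max_ideal" "g \<in> graded_max_ideal" using fs(1) fgs by auto
    have f_reg: "q \<in> I" if "f * q \<in> I" for q
    proof -
      have "\<forall>q. fs ! 0 * q \<in> ideal.span (I \<union> set (take 0 fs)) \<longrightarrow> q \<in> ideal.span (I \<union> set (take 0 fs))"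
        using fs(2) fgs unfolding regular_sequence_quot_def by blast
      moreover have "ideal.span I = I" using sub by simp
      ultimately show ?thesis using that fgs by simp
    qed
    have g_reg: "q \<in> Q" if "g * q \<in> Q" for q
    proof -
      have "1 < length fs" by (simp add: fgs)
      then have "\<forall>q. fs ! 1 * q \<in> ideal.span (I \<union> set (take 1 fs)) \<longrightarrow> q \<in> ideal.span (I \<union> set (take 1 fs))"
        using fs(2) unfolding regular_sequence_quot_def by blast
      then show ?thesis using that fgs by (simp add: Q_def)
    qed
    have IQ: "I \<subseteq> Q" using ideal.span_superset unfolding Q_def by blast
    have Q_mult: "c * q \<in> Q" if "q \<in> Q" for c q
      using that ideal.span_scale unfolding Q_def by blast
    have Q_add: "q + r \<in> Q" if "q \<in> Q" "r \<in> Q" for q r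
      using that ideal.span_add unfolding Q_def by blast
    have "f * mon \<sigma> \<in> Q"
      using Q_mult[of f "mon \<sigma>"] ideal.span_base[of f "insert f I"] by (simp add: Q_def mult.commute)
    have saturated: "w * mon \<sigma> \<in> Q" if w: "w * var z * mon \<sigma> \<in> Q" for w
    proof -
      obtain g' where "g - g' * var z \<in> P" using decompose m(2) by blast
      then have "w * ((g - g' * var z) * mon \<sigma>) \<in> Q" using P IQ Q_mult by blast
      moreover have "g' * (w * var z * mon \<sigma>) \<in> Q" using w by (rule Q_mult)
      ultimately have "w * ((g - g' * var z) * mon \<sigma>) + g' * (w * var z * mon \<sigma>) \<in> Q" by (rule Q_add)
      then have "g * (w * mon \<sigma>) \<in> Q" by (simp add: algebra_simps)
      then show ?thesis by (rule g_reg)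
    qed
    have descend: "\<exists>h. h * mon \<sigma> \<in> Q \<and> Poly_Mapping.lookup h 0 \<noteq> 0"
      if "w * mon \<sigma> \<in> Q" "Poly_Mapping.lookup w (Poly_Mapping.single z k) \<noteq> 0" for w k
      using that
    proof (induction k arbitrary: w)
      case 0
      then show ?case by auto
    next
      case (Suc k)
      show ?case
      proof (cases "Poly_Mapping.lookup w 0 = 0")
        case True
        then obtain w' where w': "w - w' * var z \<in> P" using decompose graded_max_ideal_iff by blast
        have "Poly_Mapping.lookup (w - w' * var z) (Poly_Mapping.single z (Suc k)) = 0"
          using w' unfolding P_def mem_span_vars_iff
          by (auto simp: lookup_single when_def simp flip: not_in_keys_iff_lookup_eq_zero)
        moreover have "Poly_Mapping.lookup (w' * var z) (Poly_Mapping.single z (Suc k)) =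
            Poly_Mapping.lookup w' (Poly_Mapping.single z k)"
          using lookup_mon_times[of "unit_exp z" w' "Poly_Mapping.single z k"]
          by (simp add: var_def mult.commute flip: single_add)
        ultimately have "Poly_Mapping.lookup w' (Poly_Mapping.single z k) \<noteq> 0"
          using Suc.prems(2) by (simp add: lookup_minus)
        moreover have "w' * var z * mon \<sigma> = w * mon \<sigma> + (-1) * ((w - w' * var z) * mon \<sigma>)"
          by (simp add: algebra_simps)
        then have "w' * var z * mon \<sigma> \<in> Q"
          using Suc.prems(1) P[OF w'] IQ Q_mult Q_add by (metis subsetD)
        ultimately show ?thesis using Suc.IH saturated by blast
      qed (use Suc.prems in blast)
    qed
    \<comment> \<open>An element outside \<open>P\<close> contains a pure power of \<open>z\<close>.\<close>
    have "f \<notin> P" using P f_reg \<sigma>(1) by (auto simp: N_def exps_def)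
    then obtain \<alpha> where \<alpha>: "\<alpha> \<in> Poly_Mapping.keys f" "\<forall>v. v \<noteq> z \<longrightarrow> Poly_Mapping.lookup \<alpha> v = 0"
      unfolding P_def mem_span_vars_iff by auto
    have "\<alpha> = Poly_Mapping.single z (Poly_Mapping.lookup \<alpha> z)"
      using \<alpha>(2) by (intro poly_mapping_eqI) (auto simp: lookup_single when_def)
    then obtain h where h: "h * mon \<sigma> \<in> Q" "Poly_Mapping.lookup h 0 \<noteq> 0"
      using descend[OF \<open>f * mon \<sigma> \<in> Q\<close>] \<alpha>(1) by (metis in_keys_iff)
    then obtain q where q: "h * mon \<sigma> - q * f \<in> I"
      using ideal.span_breakdown_eq[of _ f I] sub unfolding Q_def by (auto simp flip: ideal.span_eq_iff)
    \<comment> \<open>\<open>f v q\<close> agrees with \<open>h v \<sigma>\<close> modulo \<open>I\<close>, and \<open>v \<sigma>\<close> is in \<open>I\<close>.\<close>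
    have q_ann: "var v * q \<in> I" if "v \<noteq> z" for v
    proof (rule f_reg)
      have v: "var v * mon \<sigma> \<in> I" using \<sigma>(1) that by (simp add: N_def var_times_mon exps_def)
      have "h * (var v * mon \<sigma>) - var v * (h * mon \<sigma> - q * f) \<in> I"
        by (rule ideal.subspace_diff[OF sub ideal.subspace_scale[OF sub v] ideal.subspace_scale[OF sub q]])
      then show "f * (var v * q) \<in> I" by (simp add: algebra_simps)
    qed
    have "Poly_Mapping.lookup (h * mon \<sigma> - q * f) \<sigma> = 0"
      using q mem_monomial_ideal_iff[OF I] \<sigma>(1) by (auto simp: N_def not_in_keys_iff_lookup_eq_zero)
    moreover have "Poly_Mapping.lookup (h * mon \<sigma>) \<sigma> \<noteq> 0"
      using lookup_mon_times[of \<sigma> h 0] h(2) by (simp add: mult.commute)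
    ultimately have "\<sigma> \<in> Poly_Mapping.keys (q * f)" by (simp add: lookup_minus in_keys_iff)
    then obtain \<alpha> \<beta> where \<alpha>\<beta>: "\<sigma> = \<alpha> + \<beta>" "\<alpha> \<in> Poly_Mapping.keys q" "\<beta> \<in> Poly_Mapping.keys f"
      using keys_mult[of q f] by blast
    have "\<alpha> \<notin> exps I"
      using \<sigma>(1) exps_add[OF sub, of \<alpha> \<beta>] by (auto simp: N_def \<alpha>\<beta>(1) add.commute)
    moreover have "unit_exp v + \<alpha> \<in> exps I" if "v \<noteq> z" for v
    proof -
      have "unit_exp v + \<alpha> \<in> Poly_Mapping.keys (var v * q)"
        using lookup_mon_times[of "unit_exp v" q \<alpha>] \<alpha>\<beta>(2) by (simp add: var_def in_keys_iff)
      then show ?thesis using q_ann[OF that] mem_monomial_ideal_iff[OF I] by blast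
    qed
    ultimately have "\<beta> = 0" using minimal[of \<alpha> \<beta>] \<alpha>\<beta>(1) by (simp add: N_def)
    then show False using \<alpha>\<beta>(3) m(1) by (simp add: graded_max_ideal_iff in_keys_iff)
  qed
  then show ?thesis
    unfolding depth_quot_def by (intro SUP_least) (auto simp: one_enat_def)
qed

text \<open>
  If the term \<open>\<alpha>\<close> of \<open>g\<close> has no multiple \<open>y\<^sup>k \<alpha>\<close> in \<open>I\<close>, then \<open>y \<alpha>\<close> must cancel in \<open>(y + z) g\<close>
  against \<open>z \<beta>\<close> for another term \<open>\<beta>\<close>. This \<open>\<beta>\<close> has the same property and a smaller exponent of \<open>z\<close>,
  so the argument descends on that exponent.
\<close>

lemma torsion_of_mult_var_add_var:
  assumes I: "monomial_ideal I" and "y \<noteq> z" and g: "(var y + var z) * g \<in> I"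
    and \<alpha>: "\<alpha> \<in> Poly_Mapping.keys g"
  shows "\<exists>k. Poly_Mapping.single y k + \<alpha> \<in> exps I"
  using \<alpha>
proof (induction "Poly_Mapping.lookup \<alpha> z" arbitrary: \<alpha> rule: less_induct)
  case less
  show ?case
  proof (cases "unit_exp y + \<alpha> \<in> exps I")
    case False
    have "Poly_Mapping.lookup ((var y + var z) * g) (unit_exp y + \<alpha>) = 0"
      using False g mem_monomial_ideal_iff[OF I] by (auto simp: not_in_keys_iff_lookup_eq_zero)
    moreover have "Poly_Mapping.lookup (var y * g) (unit_exp y + \<alpha>) \<noteq> 0"
      using less.prems by (simp add: var_def lookup_mon_times in_keys_iff del: One_nat_def)
    ultimately have "unit_exp y + \<alpha> \<in> Poly_Mapping.keys (var z * g)"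
      by (auto simp: distrib_right lookup_add in_keys_iff)
    then obtain \<beta> where \<beta>: "\<beta> \<in> Poly_Mapping.keys g" "unit_exp y + \<alpha> = unit_exp z + \<beta>"
      using keys_mult[of "var z" g] by (auto simp: var_def split: if_splits)
    have "Poly_Mapping.lookup \<alpha> z = Suc (Poly_Mapping.lookup \<beta> z)"
      using arg_cong[OF \<beta>(2), of "\<lambda>\<gamma>. Poly_Mapping.lookup \<gamma> z"] \<open>y \<noteq> z\<close>
      by (simp add: lookup_add lookup_single)
    then obtain k where "Poly_Mapping.single y k + \<beta> \<in> exps I" using less.hyps \<beta>(1) by auto
    then have "unit_exp z + (Poly_Mapping.single y k + \<beta>) \<in> exps I"
      by (rule exps_add[OF monomial_ideal_subspace[OF I]])
    also have "unit_exp z + (Poly_Mapping.single y k + \<beta>) = Poly_Mapping.single y k + (unit_exp y + \<alpha>)"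
      by (simp only: \<beta>(2) add.left_commute)
    also have "\<dots> = Poly_Mapping.single y (k + 1) + \<alpha>"
      by (simp only: single_add add.assoc)
    finally show ?thesis by blast
  qed blast
qed

text \<open>
  Every term of \<open>g\<close> is torsion for \<open>y\<close> by descent on the exponent of \<open>z\<close>, and torsion for \<open>z\<close> by the
  symmetric argument; the assumption then puts it into \<open>I\<close>. It leaves room for \<open>y\<close> and \<open>z\<close> themselves to
  be zerodivisors, which is why their sum is taken.
\<close>

lemma var_add_var_regular:
  assumes I: "monomial_ideal I" and "y \<noteq> z"
    and free: "\<And>\<alpha>. \<exists>k. Poly_Mapping.single y k + \<alpha> \<in> exps I \<Longrightarrow>
      \<exists>k. Poly_Mapping.single z k + \<alpha> \<in> exps I \<Longrightarrow> \<alpha> \<in> exps I"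
    and g: "(var y + var z) * g \<in> I"
  shows "g \<in> I"
proof -
  have g': "(var z + var y) * g \<in> I" using g by (simp add: add.commute)
  have "\<alpha> \<in> exps I" if "\<alpha> \<in> Poly_Mapping.keys g" for \<alpha>
    using free torsion_of_mult_var_add_var[OF I \<open>y \<noteq> z\<close> g that]
      torsion_of_mult_var_add_var[OF I \<open>y \<noteq> z\<close>[symmetric] g' that] by blast
  then show ?thesis using mem_monomial_ideal_iff[OF I] by blast
qed

section \<open>Principal monomial ideals in two variables\<close>

text \<open>
  The region below an upward closed set of lattice points is a staircase, and an inner corner of
  the staircase is a point outside the set whose right and upper neighbours are inside. Without such
  a corner, a point of the leftmost column and one of the lowest row can be slid towards each other
  until they meet at the vertex of a quadrant.
\<close>

lemma quadrant_if_no_corner: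
  fixes E :: "nat \<Rightarrow> nat \<Rightarrow> bool"
  assumes up: "\<And>b c. E b c \<Longrightarrow> E (Suc b) c" "\<And>b c. E b c \<Longrightarrow> E b (Suc c)"
    and no_corner: "\<And>b c. E (Suc b) c \<Longrightarrow> E b (Suc c) \<Longrightarrow> E b c"
    and ne: "E b\<^sub>0 c\<^sub>0"
  obtains m n where "\<And>b c. E b c \<longleftrightarrow> m \<le> b \<and> n \<le> c"
proof -
  have up': "E (b + d) (c + e)" if "E b c" for b c d e
    using that by (induction d; induction e) (auto intro: up)
  define m n where "m = (LEAST b. \<exists>c. E b c)" and "n = (LEAST c. \<exists>b. E b c)"
  have le: "m \<le> b" "n \<le> c" if "E b c" for b c
    using that unfolding m_def n_def by (blast intro: Least_le)+
  obtain c b where "E m c" "E b n"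
    using LeastI_ex[of "\<lambda>b. \<exists>c. E b c"] LeastI_ex[of "\<lambda>c. \<exists>b. E b c"] ne
    unfolding m_def n_def by blast
  then obtain d e where de: "E (m + d) n" "E m (n + e)"
    using le by (metis le_iff_add)
  \<comment> \<open>Slide down column \<open>b\<close>, the column to its right being in the set from height \<open>c\<close> on.\<close>
  have left: "E b c" if "E (Suc b) c" "E b (c + e)" for b c e
    using that(2)
  proof (induction e)
    case (Suc e)
    have "E (Suc b) (c + e)" using up'[OF that(1), of 0 e] by simp
    then show ?case using Suc no_corner by simp
  qed simp
  have "E m n"
    using de(1)
  proof (induction d)
    case (Suc d)
    have "E (m + d) (n + e)" using up'[OF de(2), of d 0] by simp
    then show ?case using Suc left by simp
  qed simp
  then have "E b c \<longleftrightarrow> m \<le> b \<and> n \<le> c" for b c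
    using up'[of m n "b - m" "c - n"] le by auto
  then show ?thesis using that by blast
qed

lemma principal_if_no_socle:
  fixes L :: "(yz, 'k::comm_ring_1) pring set"
  assumes L: "monomial_ideal L" "exps L \<noteq> {}"
    and no_socle: "\<And>\<beta>. \<forall>w. unit_exp w + \<beta> \<in> exps L \<Longrightarrow> \<beta> \<in> exps L"
  obtains \<gamma> where "\<And>\<beta>. \<beta> \<in> exps L \<longleftrightarrow> (\<exists>\<delta>. \<beta> = \<gamma> + \<delta>)"
proof -
  define e where "e b c = Poly_Mapping.single Y' b + Poly_Mapping.single Z' c" for b c :: nat
  have e: "\<beta> = e (Poly_Mapping.lookup \<beta> Y') (Poly_Mapping.lookup \<beta> Z')" for \<beta>
    by (simp add: e_def poly_mapping_eq_iff fun_eq_iff all_yz lookup_add lookup_single)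
  have e_lookup: "Poly_Mapping.lookup (e b c) Y' = b" "Poly_Mapping.lookup (e b c) Z' = c" for b c
    by (simp_all add: e_def lookup_add lookup_single)
  have e_Suc: "unit_exp Y' + e b c = e (Suc b) c" "unit_exp Z' + e b c = e b (Suc c)" for b c
    by (simp_all add: e_def poly_mapping_eq_iff fun_eq_iff all_yz lookup_add lookup_single)
  have up: "unit_exp w + \<beta> \<in> exps L" if "\<beta> \<in> exps L" for w \<beta>
    using exps_add[OF monomial_ideal_subspace] L(1) that by blast
  have e_mem: "\<beta> \<in> exps L \<longleftrightarrow> e (Poly_Mapping.lookup \<beta> Y') (Poly_Mapping.lookup \<beta> Z') \<in> exps L" for \<beta>
    by (rule arg_cong[OF e])
  have corner: "e b c \<in> exps L" if "e (Suc b) c \<in> exps L" "e b (Suc c) \<in> exps L" for b c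
    using no_socle[unfolded all_yz, of "e b c"] that by (simp only: e_Suc)
  have e_up: "e (Suc b) c \<in> exps L" "e b (Suc c) \<in> exps L" if "e b c \<in> exps L" for b c
    using up[OF that] by (metis e_Suc)+
  obtain \<beta>\<^sub>0 where "\<beta>\<^sub>0 \<in> exps L" using L(2) by blast
  then have "e (Poly_Mapping.lookup \<beta>\<^sub>0 Y') (Poly_Mapping.lookup \<beta>\<^sub>0 Z') \<in> exps L" using e_mem by blast
  then obtain m n where mn: "\<And>b c. e b c \<in> exps L \<longleftrightarrow> m \<le> b \<and> n \<le> c"
    using quadrant_if_no_corner[of "\<lambda>b c. e b c \<in> exps L", OF e_up corner] by blast
  have "\<beta> \<in> exps L \<longleftrightarrow> (\<exists>\<delta>. \<beta> = e m n + \<delta>)" for \<beta>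
    using e_mem[of \<beta>] unfolding exponent_dvd_iff all_yz e_lookup mn .
  then show ?thesis using that by blast
qed

section \<open>Ideals assembled from layers\<close>

locale layered_monomial_ideal =
  fixes p a :: nat
    and i :: "nat \<Rightarrow> nat"
    and J :: "nat \<Rightarrow> (yz, 'k::comm_ring_1) pring set"
    and I :: "(xyz, 'k) pring set"
  assumes i_0: "i 0 = 0"
    and i_Suc: "\<forall>j<p. i j < i (Suc j)"
    and i_p: "i p < a"
    and J: "\<forall>j\<le>p. monomial_ideal (J j) \<and> J j \<noteq> {0} \<and> J j \<noteq> UNIV"
    and I: "I = ideal.span {var X ^ a} + (\<Sum>j\<le>p. xpow_ideal (i j) (J j))"
begin

lemma i_mono: "j \<le> k \<Longrightarrow> k \<le> p \<Longrightarrow> i j \<le> i k"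
proof (induction k rule: dec_induct)
  case (step k)
  then show ?case using i_Suc by (metis Suc_le_lessD le_trans less_imp_le)
qed simp

lemma i_strict_mono: "j < k \<Longrightarrow> k \<le> p \<Longrightarrow> i j < i k"
  using i_mono[of "Suc j" k] i_Suc by (metis Suc_leI less_le_trans)

lemma monomial_ideal_I: "monomial_ideal I"
  and mem_exps_I: "xexp n \<beta> \<in> exps I \<longleftrightarrow> a \<le> n \<or> (\<exists>j\<le>p. i j \<le> n \<and> \<beta> \<in> exps (J j))"
proof -
  have x: "{var X ^ a} \<subseteq> (monomials :: (xyz, 'k) pring set)"
    by (simp add: var_power mon_in_monomials)
  then have X: "monomial_ideal (ideal.span {var X ^ a :: (xyz, 'k) pring})"
    unfolding monomial_ideal_def by blast
  have "xexp n \<beta> \<in> exps (ideal.span {var X ^ a :: (xyz, 'k) pring}) \<longleftrightarrow>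
      (\<exists>\<gamma>. xexp n \<beta> = Poly_Mapping.single X a + \<gamma>)"
    unfolding exps_span[OF x] by (simp add: var_power mon_dvd_iff)
  moreover have "Poly_Mapping.single X a = xexp a 0"
    by (simp add: xexp_def emb_exp_def)
  ultimately have eX: "xexp n \<beta> \<in> exps (ideal.span {var X ^ a :: (xyz, 'k) pring}) \<longleftrightarrow> a \<le> n"
    by (simp add: xexp_dvd_iff)
  have S: "monomial_ideal (\<Sum>j\<le>p. xpow_ideal (i j) (J j))"
    "exps (\<Sum>j\<le>p. xpow_ideal (i j) (J j)) = (\<Union>j\<le>p. exps (xpow_ideal (i j) (J j)))"
    using monomial_ideal_sum[of "{..p}" "\<lambda>j. xpow_ideal (i j) (J j)"] J xpow_ideal_exps(1) by auto
  have xpow: "xexp n \<beta> \<in> exps (xpow_ideal (i j) (J j)) \<longleftrightarrow> i j \<le> n \<and> \<beta> \<in> exps (J j)" if "j \<le> p" for j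
    using J that by (intro xpow_ideal_exps(2)) blast
  show "monomial_ideal I" unfolding I by (rule monomial_ideal_set_plus[OF X S(1)])
  show "xexp n \<beta> \<in> exps I \<longleftrightarrow> a \<le> n \<or> (\<exists>j\<le>p. i j \<le> n \<and> \<beta> \<in> exps (J j))"
    unfolding I monomial_ideal_set_plus(2)[OF X S(1)] S(2) using eX xpow by auto
qed

lemma exps_J_nonempty: "j \<le> p \<Longrightarrow> exps (J j) \<noteq> {}"
proof
  assume "j \<le> p" "exps (J j) = {}"
  then have "J j \<subseteq> {0}" using J mem_monomial_ideal_iff by fastforce
  moreover have "0 \<in> J j" using J \<open>j \<le> p\<close> monomial_ideal_subspace ideal.subspace_0 by blast
  ultimately show False using J \<open>j \<le> p\<close> by blast
qed

section \<open>Depth one forces a chain of principal ideals\<close>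

text \<open>
  The monomials \<open>\<beta>\<close> in \<open>y, z\<close> with \<open>x\<^sup>n \<beta> \<in> I\<close> are those of \<open>slice k\<close>, for the last
  \<open>k \<le> p\<close> with \<open>i k \<le> n\<close>, as long as \<open>n < a\<close>.
\<close>

definition slice :: "nat \<Rightarrow> (yz, 'k) pring set"
  where "slice k = (\<Sum>j\<le>k. J j)"

lemma slice:
  assumes "k \<le> p"
  shows "monomial_ideal (slice k)" "exps (slice k) = (\<Union>j\<le>k. exps (J j))"
  using monomial_ideal_sum[of "{..k}" J] J assms by (auto simp: slice_def)

text \<open>
  A socle monomial \<open>\<beta>\<close> of \<open>K[y,z]\<close> modulo the slice gives monomials \<open>x\<^sup>n \<beta>\<close>, for \<open>n \<ge> i k\<close>,
  that \<open>y\<close> and \<open>z\<close> multiply into \<open>I\<close>; the one for \<open>n = i k\<close> is outside \<open>I\<close>. Since a power of \<open>x\<close> is in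
  \<open>I\<close>, there is a largest \<open>n\<close> with \<open>x\<^sup>n \<beta>\<close> outside \<open>I\<close>, and for this \<open>n\<close> also \<open>x\<close> multiplies it into \<open>I\<close>.
\<close>

lemma slice_no_socle:
  assumes depth: "depth_quot graded_max_ideal I \<noteq> 0" and k: "k \<le> p"
    and up: "\<forall>w. unit_exp w + \<beta> \<in> exps (slice k)"
  shows "\<beta> \<in> exps (slice k)"
proof (rule ccontr)
  assume \<beta>: "\<beta> \<notin> exps (slice k)"
  define A where "A = {n. xexp n \<beta> \<notin> exps I}"
  have ik: "i k \<in> A"
  proof -
    have "j \<le> k" if "j \<le> p" "i j \<le> i k" for j
      using i_strict_mono[of k j] that by (metis not_le)
    moreover have "i k < a" using i_mono[OF k] i_p by simp
    ultimately show ?thesis using \<beta> unfolding A_def slice(2)[OF k] by (auto simp: mem_exps_I)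
  qed
  have "A \<subseteq> {..<a}" by (auto simp: A_def mem_exps_I)
  then have fin: "finite A" using finite_subset by blast
  define n where "n = Max A"
  have n: "n \<in> A" "i k \<le> n" unfolding n_def using Max_in[OF fin] Max_ge[OF fin ik] ik by blast+
  have "Suc n \<notin> A" using Max_ge[OF fin, of "Suc n"] by (auto simp: n_def)
  have "unit_exp v + xexp n \<beta> \<in> exps I" for v
  proof -
    have *: "xexp n (unit_exp w + \<beta>) \<in> exps I" for w
    proof -
      obtain j where "j \<le> k" "unit_exp w + \<beta> \<in> exps (J j)"
        using up unfolding slice(2)[OF k] by blast
      then show ?thesis using n(2) i_mono[of j k] k unfolding mem_exps_I by (meson le_trans)
    qed
    show ?thesis
      by (cases v) (use * \<open>Suc n \<notin> A\<close> in \<open>simp_all only: unit_exp_add_xexp A_def mem_Collect_eq not_not\<close>)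
  qed
  then have "var v * mon (xexp n \<beta>) \<in> I" for v by (simp add: exps_def var_times_mon)
  moreover have "mon (xexp n \<beta>) \<notin> I" using n(1) by (simp add: A_def exps_def)
  ultimately have "depth_quot graded_max_ideal I = 0"
    using depth_quot_eq_0_if_socle monomial_ideal_subspace[OF monomial_ideal_I] by blast
  then show False using depth by simp
qed

text \<open>
  If \<open>J k\<close> were contained in an earlier \<open>J j\<close>, then a generator of \<open>x\<^bsup>i k\<^esup> J k\<close> would be properly
  divisible by a monomial of \<open>I\<close> with the smaller \<open>x\<close>-exponent \<open>i j\<close>, and would not be a minimal
  generator of \<open>I\<close>.
\<close>

lemma not_exps_subset:
  assumes gens: "min_gens I = {var X ^ a} \<union> (\<Union>j\<le>p. min_gens (xpow_ideal (i j) (J j)))"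
    and "j < k" "k \<le> p"
  shows "\<not> exps (J k) \<subseteq> exps (J j)"
proof
  assume sub: "exps (J k) \<subseteq> exps (J j)"
  have mJ: "monomial_ideal (J k)" using J assms(3) by blast
  define G where "G = min_gens (xpow_ideal (i k) (J k))"
  have G: "G \<subseteq> monomials" "ideal.span G = xpow_ideal (i k) (J k)"
    using is_min_gens_min_gens[OF xpow_ideal_exps(1)[OF mJ]] by (auto simp: G_def is_min_gens_def)
  obtain \<beta>\<^sub>0 where "\<beta>\<^sub>0 \<in> exps (J k)" using exps_J_nonempty assms(3) by blast
  then have "xexp (i k) \<beta>\<^sub>0 \<in> exps (ideal.span G)" unfolding G(2) by (simp add: xpow_ideal_exps(2)[OF mJ])
  then obtain m where m: "m \<in> G" using exps_span[OF G(1)] by blast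
  then obtain n \<beta> where m_eq: "m = mon (xexp n \<beta>)"
    using G(1) xexp_cases unfolding monomials_def by (metis imageE subsetD)
  have "m \<in> ideal.span G" using m by (rule ideal.span_base)
  then have "xexp n \<beta> \<in> exps (xpow_ideal (i k) (J k))" by (simp only: exps_def m_eq G(2) mem_Collect_eq)
  then have n: "i k \<le> n" and \<beta>: "\<beta> \<in> exps (J k)" by (simp_all add: xpow_ideal_exps(2)[OF mJ])
  have I_gens: "is_min_gens I (min_gens I)" using is_min_gens_min_gens monomial_ideal_I by blast
  then have mono: "min_gens I \<subseteq> monomials" and span: "ideal.span (min_gens I) = I"
    by (auto simp: is_min_gens_def)
  have "xexp (i j) \<beta> \<in> exps (ideal.span (min_gens I))"
    unfolding span mem_exps_I using sub \<beta> assms(2,3) by (auto intro!: exI[of _ j])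
  then obtain g where g: "g \<in> min_gens I" "g dvd mon (xexp (i j) \<beta>)"
    using exps_span[OF mono] by blast
  have "m \<in> min_gens I" using m assms(3) unfolding gens G_def by blast
  have ij: "i j < i k" using i_strict_mono assms(2,3) .
  then have "(mon (xexp (i j) \<beta>) :: (xyz, 'k) pring) dvd m"
    using n unfolding m_eq mon_dvd_iff xexp_dvd_iff by (metis add_0_right le_trans less_imp_le)
  then have "g = m"
    using min_gens_antichain[OF I_gens g(1) \<open>m \<in> min_gens I\<close>] g(2) dvd_trans by blast
  then have "(mon (xexp n \<beta>) :: (xyz, 'k) pring) dvd mon (xexp (i j) \<beta>)" using g(2) m_eq by simp
  then have "n \<le> i j" unfolding mon_dvd_iff xexp_dvd_iff by blast
  then show False using n ij by simp
qed

text \<open>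
  Each slice is principal because it has no socle. Its generator \<open>\<gamma> k\<close> lies in one of \<open>J 0, \<dots>, J k\<close>; if it
  were in an earlier one than \<open>J k\<close>, that ideal would contain the slice and therefore \<open>J k\<close>. So \<open>\<gamma> k\<close> is in
  \<open>J k\<close> and generates it. The slices increase, which gives the divisions, and these are strict because \<open>\<gamma> k\<close> is
  not in \<open>J j\<close> for \<open>j < k\<close>.
\<close>

lemma principal_chain_if_depth:
  assumes gens: "min_gens I = {var X ^ a} \<union> (\<Union>j\<le>p. min_gens (xpow_ideal (i j) (J j)))"
    and depth: "depth_quot graded_max_ideal I \<noteq> 0"
  shows "\<exists>u. (\<forall>j\<le>p. u j \<in> monomials \<and> J j = ideal.span {u j}) \<and>
      (\<forall>j<p. u (Suc j) dvd u j \<and> u (Suc j) \<noteq> u j)"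
proof -
  have "\<exists>\<gamma>. \<forall>\<beta>. \<beta> \<in> exps (slice k) \<longleftrightarrow> (\<exists>\<delta>. \<beta> = \<gamma> + \<delta>)" if k: "k \<le> p" for k
  proof -
    have "exps (slice k) \<noteq> {}" unfolding slice(2)[OF k] using exps_J_nonempty[of 0] by auto
    then show ?thesis
      using principal_if_no_socle[OF slice(1)[OF k]] slice_no_socle[OF depth k] by metis
  qed
  then obtain \<gamma> where \<gamma>: "\<And>k \<beta>. k \<le> p \<Longrightarrow> \<beta> \<in> exps (slice k) \<longleftrightarrow> (\<exists>\<delta>. \<beta> = \<gamma> k + \<delta>)" by metis
  have not_earlier: "\<gamma> k \<notin> exps (J j)" if "j < k" "k \<le> p" for j k
  proof
    assume *: "\<gamma> k \<in> exps (J j)"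
    have "ideal.subspace (J j)" using J that monomial_ideal_subspace by (meson le_trans less_imp_le)
    then have "\<beta> \<in> exps (J j)" if "\<beta> \<in> exps (slice k)" for \<beta>
      using \<gamma>[OF \<open>k \<le> p\<close>] that exps_add[OF _ *] by (metis add.commute)
    then have "exps (J k) \<subseteq> exps (J j)" unfolding slice(2)[OF \<open>k \<le> p\<close>] by blast
    then show False using not_exps_subset[OF gens that] by simp
  qed
  have \<gamma>_mem: "\<gamma> k \<in> exps (J k)" if k: "k \<le> p" for k
  proof -
    have "\<gamma> k \<in> exps (slice k)" using \<gamma>[OF k] by (metis add_0_right)
    then obtain j where "j \<le> k" "\<gamma> k \<in> exps (J j)" unfolding slice(2)[OF k] by blast
    then show ?thesis using not_earlier[OF _ k] by (metis le_neq_implies_less)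
  qed
  have eq: "J k = ideal.span {mon (\<gamma> k)}" if k: "k \<le> p" for k
  proof (rule monomial_ideal_eqI)
    show mJ: "monomial_ideal (J k)" using J k by blast
    show "exps (J k) = exps (ideal.span {mon (\<gamma> k)})"
    proof (rule set_eqI)
      fix \<beta>
      have "\<beta> \<in> exps (slice k)" if "\<beta> \<in> exps (J k)" using that unfolding slice(2)[OF k] by blast
      moreover have "\<beta> \<in> exps (J k)" if "\<beta> = \<gamma> k + \<delta>" for \<delta>
        using exps_add[OF monomial_ideal_subspace[OF mJ] \<gamma>_mem[OF k]] that by (metis add.commute)
      ultimately show "\<beta> \<in> exps (J k) \<longleftrightarrow> \<beta> \<in> exps (ideal.span {mon (\<gamma> k)})"
        unfolding exps_span_mon using \<gamma>[OF k] by blast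
    qed
  qed (rule monomial_ideal_span_mon)
  have "mon (\<gamma> (Suc j)) dvd (mon (\<gamma> j) :: (yz, 'k) pring) \<and>
      mon (\<gamma> (Suc j)) \<noteq> (mon (\<gamma> j) :: (yz, 'k) pring)" if j: "j < p" for j
  proof
    have le: "j \<le> p" "Suc j \<le> p" using j by simp_all
    have "\<gamma> j \<in> exps (slice (Suc j))" unfolding slice(2)[OF le(2)] using \<gamma>_mem[OF le(1)] by auto
    then show "mon (\<gamma> (Suc j)) dvd (mon (\<gamma> j) :: (yz, 'k) pring)"
      unfolding mon_dvd_iff using \<gamma>[OF le(2)] by blast
    show "mon (\<gamma> (Suc j)) \<noteq> (mon (\<gamma> j) :: (yz, 'k) pring)"
    proof
      assume "mon (\<gamma> (Suc j)) = (mon (\<gamma> j) :: (yz, 'k) pring)"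
      then have "\<gamma> (Suc j) = \<gamma> j" by (metis keys_single singleton_insert_inj_eq zero_neq_one)
      then show False using not_earlier[of j "Suc j"] \<gamma>_mem[of j] le by simp
    qed
  qed
  then show ?thesis using eq by (intro exI[of _ "\<lambda>j. mon (\<gamma> j)"]) (simp add: mon_in_monomials)
qed

section \<open>A chain of principal ideals has depth one\<close>

text \<open>
  Let \<open>J p = (w \<delta>)\<close> with \<open>w\<close> one of \<open>y, z\<close>. Then \<open>x\<^bsup>a - 1\<^esup> \<delta>\<close> is outside \<open>I\<close> but annihilated by
  \<open>x\<close> and \<open>w\<close>, which bounds the depth by one. The element \<open>y + z\<close> is regular: at each power of
  \<open>x\<close> below \<open>a\<close> the ideal consists of the multiples of a single monomial, and a monomial that becomes
  such a multiple both after multiplication by a power of \<open>y\<close> and after multiplication by a power of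
  \<open>z\<close> is one already.
\<close>

lemma depth_if_principal_chain:
  assumes u: "\<forall>j\<le>p. u j \<in> monomials \<and> J j = ideal.span {u j}" and dvd: "\<forall>j<p. u (Suc j) dvd u j"
  shows "depth_quot graded_max_ideal I = 1"
proof (rule antisym)
  note sub = monomial_ideal_subspace[OF monomial_ideal_I]
  have "\<forall>j\<le>p. \<exists>\<gamma>. u j = mon \<gamma>" using u by (auto simp: monomials_def)
  then obtain \<gamma> where \<gamma>: "\<And>j. j \<le> p \<Longrightarrow> u j = mon (\<gamma> j)" by metis
  have exps_J: "\<beta> \<in> exps (J j) \<longleftrightarrow> (\<exists>\<delta>. \<beta> = \<gamma> j + \<delta>)" if "j \<le> p" for j \<beta>
    using u \<gamma> that by (simp add: exps_span_mon)
  have chain: "u k dvd u j" if "j \<le> k" "k \<le> p" for j k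
    using that
  proof (induction k rule: dec_induct)
    case (step k)
    then show ?case using dvd by (metis Suc_le_lessD dvd_trans less_imp_le)
  qed simp
  have exps_J_mono: "\<beta> \<in> exps (J k)" if "\<beta> \<in> exps (J j)" "j \<le> k" "k \<le> p" for j k \<beta>
  proof -
    have "(mon (\<gamma> k) :: (yz, 'k) pring) dvd mon (\<gamma> j)" using chain[OF that(2,3)] \<gamma> that by simp
    then show ?thesis using that exps_J unfolding mon_dvd_iff by (metis add.assoc le_trans)
  qed
  have "\<gamma> p \<noteq> 0"
  proof
    assume "\<gamma> p = 0"
    then have "J p = ideal.span {1}" using u \<gamma> by simp
    then have "J p = UNIV" by (auto simp: ideal.span_singleton)
    then show False using J by blast
  qed
  then obtain w where "Poly_Mapping.lookup (\<gamma> p) w \<noteq> 0" by (metis lookup_zero poly_mapping_eqI)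
  then obtain \<delta> where \<delta>: "\<gamma> p = unit_exp w + \<delta>" by (rule exponent_split_var)
  have out: "xexp (a - 1) \<delta> \<notin> exps I"
  proof
    assume "xexp (a - 1) \<delta> \<in> exps I"
    then obtain j where "j \<le> p" "\<delta> \<in> exps (J j)" using i_p by (auto simp: mem_exps_I)
    then have "\<delta> \<in> exps (J p)" using exps_J_mono by blast
    then obtain \<epsilon> where "\<delta> = \<gamma> p + \<epsilon>" using exps_J by blast
    then have "Poly_Mapping.lookup \<delta> w = Poly_Mapping.lookup (unit_exp w + \<delta> + \<epsilon>) w" using \<delta> by simp
    then show False by (simp add: lookup_add)
  qed
  have inX: "unit_exp X + xexp (a - 1) \<delta> \<in> exps I"
    using i_p by (simp only: unit_exp_add_xexp mem_exps_I) simp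
  have "i p \<le> a - 1" using i_p by simp
  have "\<gamma> p \<in> exps (J p)" using exps_J[of p "\<gamma> p"] by (metis add_0_right order_refl)
  have inw: "xexp (a - 1) (unit_exp w + \<delta>) \<in> exps I"
    unfolding mem_exps_I \<delta>[symmetric] using \<open>i p \<le> a - 1\<close> \<open>\<gamma> p \<in> exps (J p)\<close> by blast
  show "depth_quot graded_max_ideal I \<le> 1"
  proof (cases w)
    case Y'
    have "unit_exp v + xexp (a - 1) \<delta> \<in> exps I" if "v \<noteq> Z" for v
      using that inX inw[unfolded Y' unit_exp_add_xexp(2)[symmetric]] by (cases v) simp_all
    then show ?thesis using depth_quot_le_1[OF monomial_ideal_I out] by blast
  next
    case Z'
    have "unit_exp v + xexp (a - 1) \<delta> \<in> exps I" if "v \<noteq> Y" for v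
      using that inX inw[unfolded Z' unit_exp_add_xexp(3)[symmetric]] by (cases v) simp_all
    then show ?thesis using depth_quot_le_1[OF monomial_ideal_I out] by blast
  qed
  have free: "\<alpha> \<in> exps I"
    if YZ: "Poly_Mapping.single Y k + \<alpha> \<in> exps I" "Poly_Mapping.single Z l + \<alpha> \<in> exps I" for \<alpha> k l
  proof -
    obtain n \<beta> where \<alpha>: "\<alpha> = xexp n \<beta>" by (rule xexp_cases)
    show ?thesis
    proof (cases "a \<le> n")
      case False
      then obtain j\<^sub>1 j\<^sub>2 where j: "j\<^sub>1 \<le> p" "i j\<^sub>1 \<le> n" "Poly_Mapping.single Y' k + \<beta> \<in> exps (J j\<^sub>1)"
          "j\<^sub>2 \<le> p" "i j\<^sub>2 \<le> n" "Poly_Mapping.single Z' l + \<beta> \<in> exps (J j\<^sub>2)"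
        using YZ unfolding \<alpha> unit_exp_add_xexp mem_exps_I by blast
      \<comment> \<open>The ideals increase along the chain, so the larger index serves both memberships.\<close>
      define j where "j = max j\<^sub>1 j\<^sub>2"
      have jp: "j \<le> p" "i j \<le> n" using j by (auto simp: j_def max_def)
      have "Poly_Mapping.single Y' k + \<beta> \<in> exps (J j)" "Poly_Mapping.single Z' l + \<beta> \<in> exps (J j)"
        using exps_J_mono j jp(1) by (auto simp: j_def)
      then have le: "Poly_Mapping.lookup (\<gamma> j) v \<le> Poly_Mapping.lookup (Poly_Mapping.single Y' k + \<beta>) v"
          "Poly_Mapping.lookup (\<gamma> j) v \<le> Poly_Mapping.lookup (Poly_Mapping.single Z' l + \<beta>) v" for v
        unfolding exps_J[OF jp(1)] exponent_dvd_iff by blast+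
      have "Poly_Mapping.lookup (\<gamma> j) v \<le> Poly_Mapping.lookup \<beta> v" for v
        using le[of v] by (cases v) (simp_all add: lookup_add lookup_single)
      then have "\<beta> \<in> exps (J j)" unfolding exps_J[OF jp(1)] exponent_dvd_iff by blast
      then show ?thesis using \<alpha> jp mem_exps_I by blast
    qed (simp add: \<alpha> mem_exps_I)
  qed
  have "0 \<notin> exps I"
  proof
    assume "0 \<in> exps I"
    then have "xexp (a - 1) \<delta> + 0 \<in> exps I" by (rule exps_add[OF sub])
    then show False using out by simp
  qed
  then have "I \<subseteq> graded_max_ideal"
    using mem_monomial_ideal_iff[OF monomial_ideal_I]
    by (auto simp: graded_max_ideal_iff simp flip: not_in_keys_iff_lookup_eq_zero)
  moreover have "(var Y + var Z :: (xyz, 'k) pring) \<in> graded_max_ideal"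
    unfolding graded_max_ideal_def by (intro ideal.span_add ideal.span_base) simp_all
  moreover have "g \<in> I" if "(var Y + var Z) * g \<in> I" for g
    using var_add_var_regular[OF monomial_ideal_I _ _ that] free by blast
  ultimately show "1 \<le> depth_quot graded_max_ideal I" by (rule depth_quot_ge_1[OF sub])
qed

end

theorem corollary3p9:
  fixes p a :: nat
    and i :: "nat \<Rightarrow> nat"
    and J :: "nat \<Rightarrow> (yz, 'k::field) pring set"
    and I :: "(xyz, 'k) pring set"
  assumes "i 0 = 0"
    and "\<forall>j<p. i j < i (Suc j)"
    and "i p < a"
    and "\<forall>j\<le>p. monomial_ideal (J j) \<and> J j \<noteq> {0} \<and> J j \<noteq> UNIV"
    and "I = ideal.span {var X ^ a} + (\<Sum>j\<le>p. xpow_ideal (i j) (J j))"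
    and "min_gens I = {var X ^ a} \<union> (\<Union>j\<le>p. min_gens (xpow_ideal (i j) (J j)))"
  shows "depth_quot graded_max_ideal I = 1 \<longleftrightarrow>
    (\<exists>u :: nat \<Rightarrow> (yz, 'k) pring.
      (\<forall>j\<le>p. u j \<in> monomials \<and> J j = ideal.span {u j}) \<and>
      (\<forall>j<p. u (Suc j) dvd u j \<and> u (Suc j) \<noteq> u j))"
proof -
  interpret layered_monomial_ideal p a i J I
    using assms(1-5) by unfold_locales
  show ?thesis
    using principal_chain_if_depth[OF assms(6)] depth_if_principal_chain by (metis zero_neq_one)
qed

end
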